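(* For $\mathrm{Re}(s)=0$, $\mathrm{Re}(\eta)\ge0$, $|r|<1$, $j=1,\ldots,N$, $$Z_j^w(r,s,\eta)-rp_je^{-sw}=r\sum_{i=1}^NZ_i^w(r,as,\eta)\,\beta_i^*\big(s+\psi_i(\eta-s)\big)\,\chi_{i,j}(\eta-s)+V_j^w(r,s,\eta),$$ or equivalently, in matrix notation, $$\tilde Z^w(r,s,\eta)-rX(\eta-s)B^*(s,\eta)\tilde Z^w(r,as,\eta)=re^{-sw}\widehat p+\tilde V^w(r,s,\eta),$$ where $X(s)$ is the $N\times N$ matrix whose $(j,i)$ entry is $\chi_{i,j}(s)$, and $B^*(s,\eta)=\mathrm{diag}\big(\beta_1^*(s+\psi_1(\eta-s)),\ldots,\beta_N^*(s+\psi_N(\eta-s))\big)$.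
   Context: Let $E=\{1,\ldots,N\}$, $a\in(0,1)$. Customers arrive at epochs $0=T_1\le T_2\le\cdots$, with interarrival times $A_n=T_n-T_{n-1}$ ($n\ge2$), service times $S_n\ge0$, and background states $Y_n\in E$ at arrival epochs ($n\ge1$). The workload just before the $n$th arrival satisfies $W_{n+1}=[aW_n+S_n-A_{n+1}]^+$, $n\ge1$, with $W_1=w\ge0$; $[x]^+=\max(0,x)$, $[x]^-=\min(0,x)$. Given $Y_n$, the triple $(A_{n+1},S_n,Y_{n+1})$ is independent of the past (in particular of $W_n,T_n$); given $Y_n=i$, $S_n$ has distribution function $B_i$ with Laplace–Stieltjes transform (LST) $\beta_i^*$; and $$E\big(e^{-sA_{n+1}}1_{\{Y_{n+1}=j\}}\mid S_n=t,Y_n=i\big)=\chi_{i,j}(s)e^{-\psi_i(s)t},$$ with $\psi_i(0)=0$ and $\sum_{j=1}^N\chi_{i,j}(0)=1$. Consequently $E(e^{-sA_{n+1}-\eta S_n}1_{\{Y_{n+1}=j\}}\mid Y_n=i)=\chi_{i,j}(s)\beta_i^*(\eta+\psi_i(s))$ for $\mathrm{Re}(\eta+\psi_i(s))>0$. The functions are rational: $\chi_{i,j}(s)=P^{(1)}_{i,j}(s)/\prod_{m=1}^{L_{i,j}}(s-\lambda^{(m)}_{i,j})$ and $\psi_i(s)=P_i^{(2)}(s)/\prod_{m=1}^{M_i}(s-\nu_i^{(m)})$, where $P^{(1)}_{i,j}$, $P^{(2)}_i$ are polynomials of degree at most $L_{i,j}-1$, $M_i-1$ respectively, sharing no zeros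 with the corresponding denominators, and $\mathrm{Re}(\nu_i^{(m)})<0$. Notation: $p_j=P(Y_1=j)$, $\widehat p=(p_1,\ldots,p_N)^T$, $$Z_j^w(r,s,\eta)=\sum_{n=1}^\infty r^nE\big(e^{-sW_n-\eta T_n}1_{\{Y_n=j\}}\mid W_1=w\big),$$ $$V_j^w(r,s,\eta)=\sum_{n=1}^\infty r^{n+1}E\big((1-e^{-s[aW_n+S_n-A_{n+1}]^-})e^{-\eta T_{n+1}}1_{\{Y_{n+1}=j\}}\mid W_1=w\big),$$ $\tilde Z^w=(Z_1^w,\ldots,Z_N^w)^T$, $\tilde V^w=(V_1^w,\ldots,V_N^w)^T$. *)

theory Defs
  imports "HOL-Probability.Probability"
begin

text \<open>
  Laplace-Stieltjes transform of a distribution function on the nonnegative half-line.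
  \<^const>\<open>interval_measure\<close> is the Lebesgue-Stieltjes measure, so an atom at 0 is included.
\<close>

definition LST :: "(real \<Rightarrow> real) \<Rightarrow> complex \<Rightarrow> complex" where
  "LST F z = (LINT t:{0..}|interval_measure F. exp (- z * complex_of_real t))"

text \<open>
  The library's conditional expectation is real-valued; the complex version is taken
  componentwise.
\<close>

definition complex_cond_exp ::
    "'m measure \<Rightarrow> 'm measure \<Rightarrow> ('m \<Rightarrow> complex) \<Rightarrow> 'm \<Rightarrow> complex" where
  "complex_cond_exp M F f \<omega> =
     Complex (real_cond_exp M F (\<lambda>x. Re (f x)) \<omega>) (real_cond_exp M F (\<lambda>x. Im (f x)) \<omega>)"

definition sigma_service_state ::
    "'m measure \<Rightarrow> ('m \<Rightarrow> real) \<Rightarrow> ('m \<Rightarrow> 'n) \<Rightarrow> 'm measure" where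
  "sigma_service_state M S Y =
     vimage_algebra (space M) (\<lambda>\<omega>. (S \<omega>, Y \<omega>)) (borel \<Otimes>\<^sub>M count_space UNIV)"

text \<open>
  All customer indices start at 1 and interarrival times at index 2; values of the sequences
  at smaller indices are irrelevant. The history up to the \<open>n\<close>th arrival consists of
  \<open>A\<^sub>2, \<dots>, A\<^sub>n\<close>, \<open>S\<^sub>1, \<dots>, S\<^sub>n\<^sub>-\<^sub>1\<close> and \<open>Y\<^sub>1, \<dots>, Y\<^sub>n\<close>; it determines the workloads and
  arrival epochs with index at most \<open>n\<close>.
\<close>

definition history ::
    "(nat \<Rightarrow> 'm \<Rightarrow> real) \<Rightarrow> (nat \<Rightarrow> 'm \<Rightarrow> real) \<Rightarrow> (nat \<Rightarrow> 'm \<Rightarrow> 'n) \<Rightarrow> nat \<Rightarrow> 'm \<Rightarrow>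
      (nat \<Rightarrow> real) \<times> (nat \<Rightarrow> real) \<times> (nat \<Rightarrow> 'n)" where
  "history A S Y n \<omega> =
     ((\<lambda>k\<in>{2..n}. A k \<omega>), (\<lambda>k\<in>{1..<n}. S k \<omega>), (\<lambda>k\<in>{1..n}. Y k \<omega>))"

definition history_space ::
    "nat \<Rightarrow> ((nat \<Rightarrow> real) \<times> (nat \<Rightarrow> real) \<times> (nat \<Rightarrow> 'n)) measure" where
  "history_space n =
     (\<Pi>\<^sub>M k\<in>{2..n}. borel) \<Otimes>\<^sub>M (\<Pi>\<^sub>M k\<in>{1..<n}. borel) \<Otimes>\<^sub>M (\<Pi>\<^sub>M k\<in>{1..n}. count_space UNIV)"

text \<open>
  \<open>'n\<close> is the finite set of background states. The polynomial \<open>P1 i j\<close> with poles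
  \<open>lam i j 1, \<dots>, lam i j (L i j)\<close> describes \<open>chi i j\<close>, and \<open>P2 i\<close> with poles
  \<open>nu i 1, \<dots>, nu i (K i)\<close> describes \<open>psi i\<close>. The zero polynomial has degree
  \<open>-\<infinity>\<close> mathematically but 0 in the library, whence the disjunctions in the degree bounds;
  they allow \<open>L i j = 0\<close> or \<open>K i = 0\<close> exactly when the function vanishes identically.

  Conditioning on \<open>Y n = i\<close> is conditioning on an event, and is only imposed when this event
  has positive probability; \<^const>\<open>uniform_measure\<close> is then the conditional probability measure.
\<close>

locale markov_dependent_workload = prob_space M
  for M :: "'m measure" +
  fixes a w :: real
    and T A S :: "nat \<Rightarrow> 'm \<Rightarrow> real"
    and Y :: "nat \<Rightarrow> 'm \<Rightarrow> 'n::finite"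
    and W :: "nat \<Rightarrow> 'm \<Rightarrow> real"
    and B :: "'n \<Rightarrow> real \<Rightarrow> real"
    and chi :: "'n \<Rightarrow> 'n \<Rightarrow> complex \<Rightarrow> complex"
    and psi :: "'n \<Rightarrow> complex \<Rightarrow> complex"
    and P1 :: "'n \<Rightarrow> 'n \<Rightarrow> complex poly"
    and L :: "'n \<Rightarrow> 'n \<Rightarrow> nat"
    and lam :: "'n \<Rightarrow> 'n \<Rightarrow> nat \<Rightarrow> complex"
    and P2 :: "'n \<Rightarrow> complex poly"
    and K :: "'n \<Rightarrow> nat"
    and nu :: "'n \<Rightarrow> nat \<Rightarrow> complex"
  assumes a: "0 < a" "a < 1"
    and w: "0 \<le> w"
    and T_measurable: "\<And>n. 1 \<le> n \<Longrightarrow> T n \<in> borel_measurable M"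
    and S_measurable: "\<And>n. 1 \<le> n \<Longrightarrow> S n \<in> borel_measurable M"
    and Y_measurable: "\<And>n. 1 \<le> n \<Longrightarrow> Y n \<in> M \<rightarrow>\<^sub>M count_space UNIV"
    and T_1: "\<And>\<omega>. \<omega> \<in> space M \<Longrightarrow> T 1 \<omega> = 0"
    and T_mono: "\<And>n. 1 \<le> n \<Longrightarrow> AE \<omega> in M. T n \<omega> \<le> T (n + 1) \<omega>"
    and A_eq: "\<And>n \<omega>. \<lbrakk>2 \<le> n; \<omega> \<in> space M\<rbrakk> \<Longrightarrow> A n \<omega> = T n \<omega> - T (n - 1) \<omega>"
    and S_nonneg: "\<And>n. 1 \<le> n \<Longrightarrow> AE \<omega> in M. 0 \<le> S n \<omega>"
    and W_1: "\<And>\<omega>. \<omega> \<in> space M \<Longrightarrow> W 1 \<omega> = w"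
    and W_rec: "\<And>n \<omega>. \<lbrakk>1 \<le> n; \<omega> \<in> space M\<rbrakk> \<Longrightarrow>
      W (n + 1) \<omega> = max 0 (a * W n \<omega> + S n \<omega> - A (n + 1) \<omega>)"
    and conditionally_indep: "\<And>n i. \<lbrakk>1 \<le> n; 0 < \<P>(\<omega> in M. Y n \<omega> = i)\<rbrakk> \<Longrightarrow>
      prob_space.indep_set (uniform_measure M {\<omega> \<in> space M. Y n \<omega> = i})
        (sets (vimage_algebra (space M) (\<lambda>\<omega>. (A (n + 1) \<omega>, S n \<omega>, Y (n + 1) \<omega>))
          (borel \<Otimes>\<^sub>M borel \<Otimes>\<^sub>M count_space UNIV)))
        (sets (vimage_algebra (space M) (history A S Y n) (history_space n)))"
    and B_mono: "\<And>i. mono (B i)"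
    and B_right_continuous: "\<And>i t. continuous (at_right t) (B i)"
    and B_neg: "\<And>i t. t < 0 \<Longrightarrow> B i t = 0"
    and B_at_top: "\<And>i. (B i \<longlongrightarrow> 1) at_top"
    and S_distribution: "\<And>n i t. \<lbrakk>1 \<le> n; 0 < \<P>(\<omega> in M. Y n \<omega> = i)\<rbrakk> \<Longrightarrow>
      \<P>(\<omega> in M. S n \<omega> \<le> t \<bar> Y n \<omega> = i) = B i t"
    and interarrival_transform: "\<And>n j s. \<lbrakk>1 \<le> n; 0 \<le> Re s\<rbrakk> \<Longrightarrow>
      AE \<omega> in M.
        complex_cond_exp M (sigma_service_state M (S n) (Y n))
          (\<lambda>\<omega>. exp (- s * complex_of_real (A (n + 1) \<omega>)) * of_bool (Y (n + 1) \<omega> = j)) \<omega> =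
        chi (Y n \<omega>) j s * exp (- psi (Y n \<omega>) s * complex_of_real (S n \<omega>))"
    and psi_0: "\<And>i. psi i 0 = 0"
    and chi_0: "\<And>i. (\<Sum>j\<in>UNIV. chi i j 0) = 1"
    and chi_rational: "\<And>i j s. chi i j s = poly (P1 i j) s / (\<Prod>m = 1..L i j. s - lam i j m)"
    and psi_rational: "\<And>i s. psi i s = poly (P2 i) s / (\<Prod>m = 1..K i. s - nu i m)"
    and P1_degree: "\<And>i j. P1 i j = 0 \<or> degree (P1 i j) < L i j"
    and P2_degree: "\<And>i. P2 i = 0 \<or> degree (P2 i) < K i"
    and P1_lam: "\<And>i j m. m \<in> {1..L i j} \<Longrightarrow> poly (P1 i j) (lam i j m) \<noteq> 0"
    and P2_nu: "\<And>i m. m \<in> {1..K i} \<Longrightarrow> poly (P2 i) (nu i m) \<noteq> 0"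
    and Re_nu: "\<And>i m. m \<in> {1..K i} \<Longrightarrow> Re (nu i m) < 0"

text \<open>
  Series over \<open>n \<ge> 1\<close> are written with \<open>Suc n\<close>. The initial workload is the constant \<open>w\<close>, so
  expectations given \<open>W 1 = w\<close> are plain expectations.
\<close>

definition Z_transform ::
    "'m measure \<Rightarrow> (nat \<Rightarrow> 'm \<Rightarrow> real) \<Rightarrow> (nat \<Rightarrow> 'm \<Rightarrow> real) \<Rightarrow> (nat \<Rightarrow> 'm \<Rightarrow> 'n) \<Rightarrow>
      complex \<Rightarrow> complex \<Rightarrow> complex \<Rightarrow> 'n \<Rightarrow> complex" where
  "Z_transform M W T Y r s \<eta> j =
     (\<Sum>n. r ^ Suc n *
       (LINT \<omega>|M. exp (- s * complex_of_real (W (Suc n) \<omega>) - \<eta> * complex_of_real (T (Suc n) \<omega>)) *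
          of_bool (Y (Suc n) \<omega> = j)))"

definition V_transform ::
    "'m measure \<Rightarrow> real \<Rightarrow> (nat \<Rightarrow> 'm \<Rightarrow> real) \<Rightarrow> (nat \<Rightarrow> 'm \<Rightarrow> real) \<Rightarrow>
      (nat \<Rightarrow> 'm \<Rightarrow> real) \<Rightarrow> (nat \<Rightarrow> 'm \<Rightarrow> real) \<Rightarrow> (nat \<Rightarrow> 'm \<Rightarrow> 'n) \<Rightarrow>
      complex \<Rightarrow> complex \<Rightarrow> complex \<Rightarrow> 'n \<Rightarrow> complex" where
  "V_transform M a W S A T Y r s \<eta> j =
     (\<Sum>n. r ^ (Suc n + 1) *
       (LINT \<omega>|M.
          (1 - exp (- s * complex_of_real
             (min 0 (a * W (Suc n) \<omega> + S (Suc n) \<omega> - A (Suc n + 1) \<omega>)))) *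
          exp (- \<eta> * complex_of_real (T (Suc n + 1) \<omega>)) *
          of_bool (Y (Suc n + 1) \<omega> = j)))"

text \<open>Note the transposition: row \<open>j\<close>, column \<open>i\<close> holds \<open>chi i j\<close>.\<close>

definition X_matrix :: "('n \<Rightarrow> 'n \<Rightarrow> complex \<Rightarrow> complex) \<Rightarrow> complex \<Rightarrow> complex^'n^'n" where
  "X_matrix chi s = (\<chi> j i. chi i j s)"

definition B_matrix ::
    "('n \<Rightarrow> real \<Rightarrow> real) \<Rightarrow> ('n \<Rightarrow> complex \<Rightarrow> complex) \<Rightarrow> complex \<Rightarrow> complex \<Rightarrow> complex^'n^'n" where
  "B_matrix B psi s \<eta> = (\<chi> i k. if i = k then LST (B i) (s + psi i (\<eta> - s)) else 0)"

end

theory Submission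
  imports Defs
begin

text \<open>
  The proof conditions on the state of the chain at one arrival epoch and then sums over
  all epochs. Write \<open>x = a * W n + S n - A (n + 1)\<close>, so that \<open>W (n + 1)\<close> is the positive
  part of \<open>x\<close>. One of the two parts of \<open>x\<close> always vanishes, hence
  \<open>exp (- s * x\<^sup>+) = (1 - exp (- s * x\<^sup>-)) + exp (- s * x)\<close>. Multiplied by
  \<open>exp (- \<eta> * T (n + 1))\<close> and the indicator of \<open>Y (n + 1) = j\<close>, the bracket has
  as its expectation the coefficient of \<open>r ^ (n + 1)\<close> in the \<open>V\<close>-series, while the last
  term splits, because
  \<open>T (n + 1) = T n + A (n + 1)\<close>, into the product of
  \<open>exp (- a * s * W n - \<eta> * T n)\<close>, which depends on the past, and
  \<open>exp (- s * S n) * exp (- (\<eta> - s) * A (n + 1))\<close>, which depends on the present.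

  On each event \<open>Y n = i\<close> past and present are independent, so the expectation factorises
  (\<open>integral_past_mult_present\<close>). The past contributes the coefficient of \<open>r ^ n\<close> in the
  \<open>Z\<close>-series at \<open>a * s\<close>. In the present, the interarrival time is integrated out first, given
  the service time and the state; this leaves \<open>exp (- (s + psi i (\<eta> - s)) * S n)\<close> times
  \<open>chi i j (\<eta> - s)\<close>, and averaging over the service time gives the Laplace-Stieltjes transform
  (\<open>integral_present\<close>).

  On the line \<open>Re s = 0\<close> the exponentials of \<open>x\<close> and of its parts have modulus one, and
  \<open>Re (\<eta> - s) = Re \<eta> \<ge> 0\<close>. Interarrival
  times are almost surely nonnegative, so all integrands built from the process are almost surely
  bounded: the expectations may be split
  as above, and the series converge geometrically for \<open>norm r < 1\<close>. Summing the one-step identity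
  (\<open>workload_transform_Suc\<close>) with weights \<open>r ^ (n + 1)\<close> gives the claim; the term with
  \<open>n = 1\<close> of the \<open>Z\<close>-series, to which the identity does not apply, is the explicit initial term.
\<close>

section \<open>Complex-valued conditional expectation, independence and conditioning\<close>

text \<open>
  The defining property of conditional expectation holds for the real and imaginary parts
  separately; a complex product mixes them, so all four real products must be integrable,
  which a bounded factor \<open>h\<close> guarantees.
\<close>

lemma (in sigma_finite_subalgebra) integral_mult_complex_cond_exp:
  fixes h g :: "'a \<Rightarrow> complex"
  assumes h: "h \<in> borel_measurable F" and bound: "AE x in M. norm (h x) \<le> C"
    and g: "integrable M g"
  shows "(LINT x|M. h x * complex_cond_exp M F g x) = (LINT x|M. h x * g x)"
proof -
  let ?E = "real_cond_exp M F"
  have [measurable]: "h \<in> borel_measurable F" "h \<in> borel_measurable M"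
      "g \<in> borel_measurable M"
    using h g measurable_from_subalg[OF subalg h] by auto
  have product: "integrable M (\<lambda>x. p (h x) * q (g x))"
    if "p \<in> {Re, Im}" "q \<in> {Re, Im}" for p q :: "complex \<Rightarrow> real"
  proof (rule Bochner_Integration.integrable_bound)
    show "integrable M (\<lambda>x. C * norm (g x))" using g by simp
    show "(\<lambda>x. p (h x) * q (g x)) \<in> borel_measurable M"
      using that by auto
    show "AE x in M. norm (p (h x) * q (g x)) \<le> norm (C * norm (g x))"
      using bound
    proof eventually_elim
      case (elim x)
      have "\<bar>p (h x)\<bar> \<le> C" "\<bar>q (g x)\<bar> \<le> norm (g x)"
        using that elim abs_Re_le_cmod abs_Im_le_cmod order.trans by blast+
      moreover have "0 \<le> C" using elim norm_ge_zero order.trans by blast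
      ultimately show ?case by (auto simp: abs_mult intro!: mult_mono)
    qed
  qed
  note rr = product[of Re Re, simplified] and ri = product[of Re Im, simplified]
    and ir = product[of Im Re, simplified] and ii = product[of Im Im, simplified]
  note [simp] = rr ri ir ii real_cond_exp_intg[OF rr] real_cond_exp_intg[OF ri]
    real_cond_exp_intg[OF ir] real_cond_exp_intg[OF ii]
  \<comment> \<open>Used with \<open>k = g\<close> and with \<open>k\<close> the conditional expectation of \<open>g\<close>.\<close>
  have split: "(LINT x|M. h x * k x) =
      Complex ((LINT x|M. Re (h x) * Re (k x)) - (LINT x|M. Im (h x) * Im (k x)))
        ((LINT x|M. Re (h x) * Im (k x)) + (LINT x|M. Im (h x) * Re (k x)))"
    if "integrable M (\<lambda>x. Re (h x) * Re (k x))" "integrable M (\<lambda>x. Re (h x) * Im (k x))"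
      "integrable M (\<lambda>x. Im (h x) * Re (k x))" "integrable M (\<lambda>x. Im (h x) * Im (k x))"
    for k
  proof -
    have "(LINT x|M. h x * k x) =
        (LINT x|M. of_real (Re (h x) * Re (k x) - Im (h x) * Im (k x)) +
          \<i> * of_real (Re (h x) * Im (k x) + Im (h x) * Re (k x)))"
      by (intro Bochner_Integration.integral_cong) (auto simp: complex_eq_iff)
    also have "\<dots> = of_real (LINT x|M. Re (h x) * Re (k x) - Im (h x) * Im (k x)) +
        \<i> * of_real (LINT x|M. Re (h x) * Im (k x) + Im (h x) * Re (k x))"
      using that
      by (subst Bochner_Integration.integral_add)
         (simp_all del: of_real_mult of_real_add of_real_diff)
    finally show ?thesis using that by (simp add: complex_eq_iff)
  qed
  have "(LINT x|M. h x * complex_cond_exp M F g x) =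
      Complex ((LINT x|M. Re (h x) * ?E (\<lambda>x. Re (g x)) x) - (LINT x|M. Im (h x) * ?E (\<lambda>x. Im (g x)) x))
        ((LINT x|M. Re (h x) * ?E (\<lambda>x. Im (g x)) x) + (LINT x|M. Im (h x) * ?E (\<lambda>x. Re (g x)) x))"
    by (subst split) (simp_all add: complex_cond_exp_def)
  then show ?thesis by (simp add: split)
qed

text \<open>
  Independence is given here between \<open>\<sigma>\<close>-algebras, as for the past and the present of the
  workload process; it passes to the smaller \<open>\<sigma>\<close>-algebras generated by the two integrands.
\<close>

lemma (in prob_space) integral_mult_indep_set:
  fixes f g :: "'a \<Rightarrow> complex"
  assumes indep: "indep_set (sets F) (sets G)"
    and space: "space F = space M" "space G = space M"
    and f: "f \<in> borel_measurable F" "integrable M f"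
    and g: "g \<in> borel_measurable G" "integrable M g"
  shows "(LINT x|M. f x * g x) = (LINT x|M. f x) * (LINT x|M. g x)"
proof (rule indep_var_lebesgue_integral)
  have "sigma_sets (space M) {k -` A \<inter> space M |A. A \<in> sets borel} \<subseteq> sets H"
    if "k \<in> borel_measurable H" "space H = space M" for k :: "'a \<Rightarrow> complex" and H
    using measurable_sets[OF that(1)] that(2)
    by (auto intro!: sets.sigma_sets_subset[of _ H, unfolded that(2)])
  then have "indep_set (sigma_sets (space M) {f -` A \<inter> space M |A. A \<in> sets borel})
      (sigma_sets (space M) {g -` A \<inter> space M |A. A \<in> sets borel})"
    using indep f g space unfolding indep_set_def
    by (elim indep_sets_mono_sets) (simp split: bool.split)
  then show "indep_var borel f borel g"
    unfolding indep_var_eq using f g by simp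
qed (use f g in auto)

lemma (in prob_space) integral_uniform_measure:
  fixes f :: "'a \<Rightarrow> complex"
  assumes f: "f \<in> borel_measurable M" and E: "E \<in> events" "0 < prob E"
  shows "(LINT x|uniform_measure M E. f x) = (LINT x|M. of_bool (x \<in> E) * f x) / of_real (prob E)"
proof -
  have "uniform_measure M E = density M (\<lambda>x. ennreal (indicator E x / prob E))"
    unfolding uniform_measure_def using E
    by (intro density_cong)
       (auto simp: emeasure_eq_measure divide_ennreal ennreal_indicator[symmetric] simp del: ennreal_indicator)
  then have "(LINT x|uniform_measure M E. f x) = (LINT x|M. (indicator E x / prob E) *\<^sub>R f x)"
    using f E by (subst integral_density[symmetric]) auto
  also have "\<dots> = (LINT x|M. of_bool (x \<in> E) * f x / of_real (prob E))"
    by (intro Bochner_Integration.integral_cong)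
       (auto simp: indicator_def scaleR_conv_of_real)
  finally show ?thesis by simp
qed

section \<open>Positive parts and power series\<close>

text \<open>
  One of \<open>max 0 x\<close> and \<open>min 0 x\<close> is 0 and the other is \<open>x\<close>.
\<close>

lemma exp_positive_part:
  fixes c :: complex and x :: real
  shows "exp (c * of_real (max 0 x)) = 1 - exp (c * of_real (min 0 x)) + exp (c * of_real x)"
  by (cases "0 \<le> x") auto

lemma summable_power_mult_bounded:
  fixes r :: complex
  assumes "norm r < 1" and "\<And>n. norm (x n) \<le> C"
  shows "summable (\<lambda>n. r ^ n * x n)"
proof (rule summable_comparison_test')
  show "summable (\<lambda>n. norm r ^ n * C)"
    using assms(1) by (intro summable_mult2 summable_geometric) simp
  show "norm (r ^ n * x n) \<le> norm r ^ n * C" for n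
    using assms(2)[of n] by (simp add: norm_mult norm_power mult_left_mono)
qed

section \<open>Measurability and the past of the process\<close>

context markov_dependent_workload
begin

lemma state_event [measurable]: "1 \<le> n \<Longrightarrow> {\<omega> \<in> space M. Y n \<omega> = i} \<in> events"
  using Y_measurable[of n] by measurable

lemma A_measurable: "2 \<le> n \<Longrightarrow> A n \<in> borel_measurable M"
  using T_measurable[of n] T_measurable[of "n - 1"] A_eq[of n]
  by (subst measurable_cong[where g = "\<lambda>\<omega>. T n \<omega> - T (n - 1) \<omega>"]) auto

lemma A_nonneg: "1 \<le> n \<Longrightarrow> AE \<omega> in M. 0 \<le> A (n + 1) \<omega>"
  using T_mono[of n] A_eq[of "n + 1"] by (auto elim!: AE_mp)

lemma T_nonneg: "1 \<le> n \<Longrightarrow> AE \<omega> in M. 0 \<le> T n \<omega>"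
proof (induction n rule: nat_induct_at_least)
  case base
  then show ?case using T_1 by simp
next
  case (Suc n)
  then show ?case using T_mono[of n] by auto
qed

text \<open>
  The \<open>\<sigma>\<close>-algebra generated by everything observed up to the \<open>n\<close>th arrival, including the
  state \<open>Y n\<close> but not the service time \<open>S n\<close>. Workloads and arrival epochs up to \<open>n\<close> are
  measurable for it since their recursions use only such data.
\<close>

abbreviation past :: "nat \<Rightarrow> 'm measure" where
  "past n \<equiv> vimage_algebra (space M) (history A S Y n) (history_space n)"

lemma history_measurable: "history A S Y n \<in> past n \<rightarrow>\<^sub>M history_space n"
  by (intro measurable_vimage_algebra1)
     (auto simp: history_def history_space_def space_pair_measure space_PiM PiE_def)

lemma past_A: "\<lbrakk>2 \<le> k; k \<le> n\<rbrakk> \<Longrightarrow> A k \<in> borel_measurable (past n)"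
proof -
  assume k: "2 \<le> k" "k \<le> n"
  have "(\<lambda>x. fst x k) \<in> borel_measurable (history_space n)"
    unfolding history_space_def using k
    by (auto intro!: measurable_compose[OF measurable_fst measurable_component_singleton])
  from measurable_compose[OF history_measurable this] show ?thesis
    using k by (simp add: history_def)
qed

lemma past_S: "\<lbrakk>1 \<le> k; k < n\<rbrakk> \<Longrightarrow> S k \<in> borel_measurable (past n)"
proof -
  assume k: "1 \<le> k" "k < n"
  have "(\<lambda>x. fst (snd x) k) \<in> borel_measurable (history_space n)"
    unfolding history_space_def using k
    by (auto intro!: measurable_compose[OF measurable_snd
          measurable_compose[OF measurable_fst measurable_component_singleton]])
  from measurable_compose[OF history_measurable this] show ?thesis
    using k by (simp add: history_def)
qed

lemma past_T: "\<lbrakk>1 \<le> k; k \<le> n\<rbrakk> \<Longrightarrow> T k \<in> borel_measurable (past n)"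
proof (induction k rule: nat_induct_at_least)
  case base
  then show ?case using T_1 by (subst measurable_cong[where g = "\<lambda>_. 0"]) auto
next
  case (Suc k)
  then have "T (Suc k) \<omega> = T k \<omega> + A (Suc k) \<omega>" if "\<omega> \<in> space M" for \<omega>
    using A_eq[of "Suc k" \<omega>] that by simp
  then show ?case
    using Suc past_A[of "Suc k" n]
    by (subst measurable_cong[where g = "\<lambda>\<omega>. T k \<omega> + A (Suc k) \<omega>"]) auto
qed

lemma past_W: "\<lbrakk>1 \<le> k; k \<le> n\<rbrakk> \<Longrightarrow> W k \<in> borel_measurable (past n)"
proof (induction k rule: nat_induct_at_least)
  case base
  then show ?case using W_1 by (subst measurable_cong[where g = "\<lambda>_. w"]) auto
next
  case (Suc k)
  then show ?case
    using W_rec[of k] past_A[of "Suc k" n] past_S[of k n]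
    by (subst measurable_cong[where g = "\<lambda>\<omega>. max 0 (a * W k \<omega> + S k \<omega> - A (Suc k) \<omega>)"]) auto
qed

lemma W_measurable: "1 \<le> n \<Longrightarrow> W n \<in> borel_measurable M"
proof (induction n rule: nat_induct_at_least)
  case base
  then show ?case using W_1 by (subst measurable_cong[where g = "\<lambda>_. w"]) auto
next
  case (Suc k)
  then show ?case
    using W_rec[of k] A_measurable[of "Suc k"] S_measurable[of k]
    by (subst measurable_cong[where g = "\<lambda>\<omega>. max 0 (a * W k \<omega> + S k \<omega> - A (Suc k) \<omega>)"]) auto
qed

section \<open>The present: one service time and the following interarrival time\<close>

text \<open>
  Two probability measures on the line with the same distribution function coincide, and
  \<open>B i\<close> is the distribution function of both.
\<close>

lemma service_distribution:
  assumes n: "1 \<le> n" and pos: "0 < \<P>(\<omega> in M. Y n \<omega> = i)"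
  shows "distr (uniform_measure M {\<omega> \<in> space M. Y n \<omega> = i}) borel (S n) = interval_measure (B i)"
proof -
  let ?E = "{\<omega> \<in> space M. Y n \<omega> = i}"
  have lim: "(B i \<longlongrightarrow> 0) at_bot"
    using B_neg[of _ i]
    by (intro tendsto_eventually) (auto simp: eventually_at_bot_dense)
  have S: "S n \<in> borel_measurable M" using S_measurable[OF n] .
  interpret cond: prob_space "uniform_measure M ?E"
    using pos by (intro prob_space_uniform_measure) (auto simp: emeasure_eq_measure)
  have "cdf (distr (uniform_measure M ?E) borel (S n)) t = B i t" for t
  proof -
    have "cdf (distr (uniform_measure M ?E) borel (S n)) t = \<P>(\<omega> in uniform_measure M ?E. S n \<omega> \<le> t)"
      using S by (auto simp: cdf_def measure_distr intro!: arg_cong[where f = "measure _"])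
    also have "\<dots> = \<P>(\<omega> in M. S n \<omega> \<le> t \<bar> Y n \<omega> = i)"
      using S state_event[OF n, of i] by (intro measure_uniform_measure_eq_cond_prob) (auto simp: pred_def)
    finally show ?thesis using S_distribution[OF n pos] by simp
  qed
  then show ?thesis
    using S lim B_mono B_right_continuous B_at_top
    by (intro cdf_unique cond.real_distribution_distr real_distribution_interval_measure ext)
       (auto simp: cdf_interval_measure mono_def)
qed

text \<open>
  Change of variables along \<open>S n\<close>. It holds for every complex \<open>z\<close>: where the exponential is not
  integrable, both integrals are 0 by convention.
\<close>

lemma integral_service_eq_LST:
  assumes n: "1 \<le> n"
  shows "(LINT \<omega>|M. of_bool (Y n \<omega> = i) * exp (- z * complex_of_real (S n \<omega>))) =
    of_real \<P>(\<omega> in M. Y n \<omega> = i) * LST (B i) z"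
proof (cases "\<P>(\<omega> in M. Y n \<omega> = i) = 0")
  case True
  then have "AE \<omega> in M. Y n \<omega> \<noteq> i" using state_event[OF n] by (simp add: prob_eq_0)
  then have "(LINT \<omega>|M. of_bool (Y n \<omega> = i) * exp (- z * complex_of_real (S n \<omega>))) = 0"
    by (intro integral_eq_zero_AE) auto
  then show ?thesis using True by simp
next
  case False
  then have pos: "0 < \<P>(\<omega> in M. Y n \<omega> = i)" by (simp add: zero_less_measure_iff)
  let ?E = "{\<omega> \<in> space M. Y n \<omega> = i}"
  have [measurable]: "S n \<in> borel_measurable M" using S_measurable[OF n] .
  have "LST (B i) z = (LINT t|distr (uniform_measure M ?E) borel (S n).
      indicator {0..} t *\<^sub>R exp (- z * complex_of_real t))"
    by (simp add: LST_def set_lebesgue_integral_def service_distribution[OF n pos])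
  also have "\<dots> = (LINT \<omega>|uniform_measure M ?E.
      indicator {0..} (S n \<omega>) *\<^sub>R exp (- z * complex_of_real (S n \<omega>)))"
    by (rule integral_distr) auto
  also have "\<dots> = (LINT \<omega>|M. of_bool (\<omega> \<in> ?E) *
      (indicator {0..} (S n \<omega>) *\<^sub>R exp (- z * complex_of_real (S n \<omega>)))) / of_real (prob ?E)"
    using pos state_event[OF n] by (intro integral_uniform_measure) auto
  also have "(LINT \<omega>|M. of_bool (\<omega> \<in> ?E) *
      (indicator {0..} (S n \<omega>) *\<^sub>R exp (- z * complex_of_real (S n \<omega>)))) =
      (LINT \<omega>|M. of_bool (Y n \<omega> = i) * exp (- z * complex_of_real (S n \<omega>)))"
    using S_nonneg[OF n] Y_measurable[OF n] by (intro integral_cong_AE) auto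
  finally show ?thesis using False by simp
qed

lemma service_state_measurable:
  "S n \<in> borel_measurable (sigma_service_state M (S n) (Y n))"
  "Y n \<in> sigma_service_state M (S n) (Y n) \<rightarrow>\<^sub>M count_space UNIV"
proof -
  have "(\<lambda>\<omega>. (S n \<omega>, Y n \<omega>)) \<in>
      sigma_service_state M (S n) (Y n) \<rightarrow>\<^sub>M borel \<Otimes>\<^sub>M count_space UNIV"
    unfolding sigma_service_state_def
    by (intro measurable_vimage_algebra1) (auto simp: space_pair_measure)
  from measurable_compose[OF this measurable_fst] measurable_compose[OF this measurable_snd]
  show "S n \<in> borel_measurable (sigma_service_state M (S n) (Y n))"
    "Y n \<in> sigma_service_state M (S n) (Y n) \<rightarrow>\<^sub>M count_space UNIV"
    by simp_all
qed

lemma subalgebra_service_state: "1 \<le> n \<Longrightarrow> subalgebra M (sigma_service_state M (S n) (Y n))"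
  unfolding subalgebra_def sigma_service_state_def
  using S_measurable[of n] Y_measurable[of n]
  by (intro conjI sets_image_in_sets measurable_Pair) auto

text \<open>
  The interarrival time is integrated out first, conditionally on service time and state. The
  factor \<open>exp (- psi i u * S n)\<close> so produced merges with \<open>exp (- s * S n)\<close> and shifts the
  argument of the transform of the service time.
\<close>

lemma integral_present:
  assumes n: "1 \<le> n" and s: "0 \<le> Re s" and u: "0 \<le> Re u"
  shows "(LINT \<omega>|M. of_bool (Y n \<omega> = i) * (exp (- s * complex_of_real (S n \<omega>)) *
      (exp (- u * complex_of_real (A (n + 1) \<omega>)) * of_bool (Y (n + 1) \<omega> = j)))) =
    of_real \<P>(\<omega> in M. Y n \<omega> = i) * (LST (B i) (s + psi i u) * chi i j u)"
proof -
  let ?F = "sigma_service_state M (S n) (Y n)"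
  define h where "h = (\<lambda>\<omega>. of_bool (Y n \<omega> = i) * exp (- s * complex_of_real (S n \<omega>)))"
  define g where "g = (\<lambda>\<omega>. exp (- u * complex_of_real (A (n + 1) \<omega>)) * of_bool (Y (n + 1) \<omega> = j) :: complex)"
  have [measurable]: "S n \<in> borel_measurable M" "Y n \<in> M \<rightarrow>\<^sub>M count_space UNIV"
    "Y (n + 1) \<in> M \<rightarrow>\<^sub>M count_space UNIV" "A (n + 1) \<in> borel_measurable M"
    using S_measurable Y_measurable A_measurable n by auto
  note [measurable] = service_state_measurable[of n]
  interpret finite_measure_subalgebra M ?F
    using subalgebra_service_state[OF n] by unfold_locales
  have h: "h \<in> borel_measurable ?F" "h \<in> borel_measurable M" unfolding h_def by measurable
  have h_bound: "AE \<omega> in M. norm (h \<omega>) \<le> 1"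
    using S_nonneg[OF n] by eventually_elim (use s in \<open>auto simp: h_def\<close>)
  have g: "integrable M g"
  proof (rule integrable_const_bound)
    show "AE \<omega> in M. norm (g \<omega>) \<le> 1"
      using A_nonneg[OF n] by eventually_elim (use u in \<open>auto simp: g_def norm_mult\<close>)
    show "g \<in> borel_measurable M" unfolding g_def by measurable
  qed
  have "(LINT \<omega>|M. h \<omega> * g \<omega>) = (LINT \<omega>|M. h \<omega> * complex_cond_exp M ?F g \<omega>)"
    using integral_mult_complex_cond_exp[OF h(1) h_bound g] by simp
  also have "\<dots> = (LINT \<omega>|M. of_bool (Y n \<omega> = i) *
      exp (- (s + psi i u) * complex_of_real (S n \<omega>)) * chi i j u)"
  proof (rule integral_cong_AE)
    \<comment> \<open>Measurability is inherited from the two real conditional expectations.\<close>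
    have "complex_cond_exp M ?F g = (\<lambda>\<omega>. of_real (real_cond_exp M ?F (\<lambda>x. Re (g x)) \<omega>) +
        \<i> * of_real (real_cond_exp M ?F (\<lambda>x. Im (g x)) \<omega>))"
      by (auto simp: complex_cond_exp_def complex_eq_iff)
    then show "(\<lambda>\<omega>. h \<omega> * complex_cond_exp M ?F g \<omega>) \<in> borel_measurable M"
      using h by simp
    show "AE \<omega> in M. h \<omega> * complex_cond_exp M ?F g \<omega> =
        of_bool (Y n \<omega> = i) * exp (- (s + psi i u) * complex_of_real (S n \<omega>)) * chi i j u"
      using interarrival_transform[OF n u, of j]
      by eventually_elim (auto simp: h_def g_def exp_add[symmetric] algebra_simps)
  qed simp
  also have "\<dots> = of_real \<P>(\<omega> in M. Y n \<omega> = i) * (LST (B i) (s + psi i u) * chi i j u)"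
    using integral_service_eq_LST[OF n, of i "s + psi i u"] by simp
  finally show ?thesis by (simp add: h_def g_def mult.assoc)
qed

section \<open>The one-step recursion\<close>

text \<open>
  The Markov property: under the conditional probability given \<open>Y n = i\<close>, the function \<open>H\<close> of the
  past is independent of the present, so the expectation of the product factorises. If the event
  \<open>Y n = i\<close> is null, both sides vanish.
\<close>

lemma integral_past_mult_present:
  fixes H :: "'m \<Rightarrow> complex"
  assumes n: "1 \<le> n" and s: "0 \<le> Re s" and u: "0 \<le> Re u"
    and H: "H \<in> borel_measurable (past n)" and bound: "AE \<omega> in M. norm (H \<omega>) \<le> C"
  shows "(LINT \<omega>|M. (H \<omega> * of_bool (Y n \<omega> = i)) * (exp (- s * complex_of_real (S n \<omega>)) *
      (exp (- u * complex_of_real (A (n + 1) \<omega>)) * of_bool (Y (n + 1) \<omega> = j)))) =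
    (LINT \<omega>|M. H \<omega> * of_bool (Y n \<omega> = i)) * (LST (B i) (s + psi i u) * chi i j u)"
    (is "(LINT \<omega>|M. _ \<omega> * ?G \<omega>) = _")
proof (cases "\<P>(\<omega> in M. Y n \<omega> = i) = 0")
  case True
  then have null: "AE \<omega> in M. Y n \<omega> \<noteq> i" using state_event[OF n] by (simp add: prob_eq_0)
  have "(LINT \<omega>|M. H \<omega> * of_bool (Y n \<omega> = i)) = 0"
    "(LINT \<omega>|M. (H \<omega> * of_bool (Y n \<omega> = i)) * ?G \<omega>) = 0"
    using null by (auto intro!: integral_eq_zero_AE)
  then show ?thesis by simp
next
  case False
  then have pos: "0 < \<P>(\<omega> in M. Y n \<omega> = i)" by (simp add: zero_less_measure_iff)
  let ?E = "{\<omega> \<in> space M. Y n \<omega> = i}"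
  let ?P = "uniform_measure M ?E"
  let ?present = "vimage_algebra (space M) (\<lambda>\<omega>. (A (n + 1) \<omega>, S n \<omega>, Y (n + 1) \<omega>))
    (borel \<Otimes>\<^sub>M borel \<Otimes>\<^sub>M count_space UNIV)"
  interpret cond: prob_space ?P
    using pos by (intro prob_space_uniform_measure) (auto simp: emeasure_eq_measure)
  have indep: "cond.indep_set (sets ?present) (sets (past n))"
    using conditionally_indep[OF n pos] .
  have [measurable]: "S n \<in> borel_measurable M" "Y n \<in> M \<rightarrow>\<^sub>M count_space UNIV"
    "Y (n + 1) \<in> M \<rightarrow>\<^sub>M count_space UNIV" "A (n + 1) \<in> borel_measurable M"
    using S_measurable Y_measurable A_measurable n by auto
  have "sets (past n) \<subseteq> events"
    using cond.indep_setD_ev2[OF indep] by simp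
  then have H_M [measurable]: "H \<in> borel_measurable M"
    using H by (auto simp: measurable_def)
  have triple: "(\<lambda>\<omega>. (A (n + 1) \<omega>, S n \<omega>, Y (n + 1) \<omega>)) \<in>
      ?present \<rightarrow>\<^sub>M borel \<Otimes>\<^sub>M borel \<Otimes>\<^sub>M count_space UNIV"
    by (intro measurable_vimage_algebra1) (auto simp: space_pair_measure)
  have "(\<lambda>(x, t, k). exp (- s * complex_of_real t) * (exp (- u * complex_of_real x) * of_bool (k = j)))
      \<in> borel_measurable (borel \<Otimes>\<^sub>M borel \<Otimes>\<^sub>M count_space UNIV)"
    by measurable
  from measurable_compose[OF triple this]
  have G: "?G \<in> borel_measurable ?present" by simp
  have H_int: "integrable ?P H"
    using bound state_event[OF n]
    by (intro cond.integrable_const_bound[where B = C] AE_uniform_measureI) auto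
  have "AE \<omega> in M. norm (?G \<omega>) \<le> 1"
    using S_nonneg[OF n] A_nonneg[OF n]
  proof eventually_elim
    case (elim \<omega>)
    then have "exp (- (Re s * S n \<omega>)) * exp (- (Re u * A (n + 1) \<omega>)) \<le> 1 * 1"
      using s u by (intro mult_mono) auto
    then show ?case by (simp add: norm_mult)
  qed
  then have "AE \<omega> in ?P. norm (?G \<omega>) \<le> 1"
    using state_event[OF n] by (intro AE_uniform_measureI) auto
  then have G_int: "integrable ?P ?G"
    by (rule cond.integrable_const_bound) measurable
  have average: "(LINT \<omega>|?P. f \<omega>) =
      (LINT \<omega>|M. of_bool (Y n \<omega> = i) * f \<omega>) / of_real (prob ?E)"
    if "f \<in> borel_measurable M" for f :: "'m \<Rightarrow> complex"
    using integral_uniform_measure[OF that state_event[OF n] pos]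
    by (simp cong: Bochner_Integration.integral_cong)
  have "(LINT \<omega>|?P. ?G \<omega> * H \<omega>) = (LINT \<omega>|?P. ?G \<omega>) * (LINT \<omega>|?P. H \<omega>)"
    using indep H H_int G G_int by (intro cond.integral_mult_indep_set) auto
  moreover have "(LINT \<omega>|?P. ?G \<omega> * H \<omega>) =
      (LINT \<omega>|M. (H \<omega> * of_bool (Y n \<omega> = i)) * ?G \<omega>) / of_real (prob ?E)"
    by (subst average) (measurable, simp only: mult_ac)
  moreover have "(LINT \<omega>|?P. H \<omega>) = (LINT \<omega>|M. H \<omega> * of_bool (Y n \<omega> = i)) / of_real (prob ?E)"
    by (subst average) (measurable, simp only: mult_ac)
  moreover have "(LINT \<omega>|?P. ?G \<omega>) = LST (B i) (s + psi i u) * chi i j u"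
    using pos by (subst average, measurable) (subst integral_present[OF n s u], simp)
  ultimately show ?thesis
    using pos by (simp only:) (simp add: field_simps)
qed

definition workload_transform :: "nat \<Rightarrow> complex \<Rightarrow> complex \<Rightarrow> 'n \<Rightarrow> complex" where
  "workload_transform n s \<eta> j =
     (LINT \<omega>|M. exp (- s * complex_of_real (W n \<omega>) - \<eta> * complex_of_real (T n \<omega>)) *
        of_bool (Y n \<omega> = j))"

definition idle_transform :: "nat \<Rightarrow> complex \<Rightarrow> complex \<Rightarrow> 'n \<Rightarrow> complex" where
  "idle_transform n s \<eta> j =
     (LINT \<omega>|M. (1 - exp (- s * complex_of_real
          (min 0 (a * W n \<omega> + S n \<omega> - A (n + 1) \<omega>)))) *
        exp (- \<eta> * complex_of_real (T (n + 1) \<omega>)) * of_bool (Y (n + 1) \<omega> = j))"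

lemma norm_exp_imaginary: "Re s = 0 \<Longrightarrow> norm (exp (- s * complex_of_real x)) = 1"
  by simp

lemma norm_exp_arrival_le_1:
  "\<lbrakk>1 \<le> n; 0 \<le> Re \<eta>\<rbrakk> \<Longrightarrow> AE \<omega> in M. norm (exp (- \<eta> * complex_of_real (T n \<omega>))) \<le> 1"
  using T_nonneg[of n] by (auto elim!: AE_mp)

lemma workload_transform_integrable:
  assumes n: "1 \<le> n" and s: "Re s = 0" and \<eta>: "0 \<le> Re \<eta>"
  shows "integrable M (\<lambda>\<omega>. exp (- s * complex_of_real (W n \<omega>) - \<eta> * complex_of_real (T n \<omega>)) *
        of_bool (Y n \<omega> = j))" (is "integrable M ?f")
    and "norm (workload_transform n s \<eta> j) \<le> 1"
proof -
  have [measurable]: "W n \<in> borel_measurable M" "T n \<in> borel_measurable M"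
    "Y n \<in> M \<rightarrow>\<^sub>M count_space UNIV"
    using W_measurable T_measurable Y_measurable n by auto
  have bound: "AE \<omega> in M. norm (?f \<omega>) \<le> 1"
    using norm_exp_arrival_le_1[OF n \<eta>]
    by eventually_elim (use s in \<open>auto simp: norm_mult\<close>)
  show int: "integrable M ?f"
    using bound by (rule integrable_const_bound) measurable
  have "norm (workload_transform n s \<eta> j) \<le> (LINT \<omega>|M. norm (?f \<omega>))"
    unfolding workload_transform_def by (rule integral_norm_bound)
  also have "\<dots> \<le> 1" using int bound by (intro integral_le_const) auto
  finally show "norm (workload_transform n s \<eta> j) \<le> 1" .
qed

lemma idle_transform_integrable:
  assumes n: "1 \<le> n" and s: "Re s = 0" and \<eta>: "0 \<le> Re \<eta>"
  shows "integrable M (\<lambda>\<omega>. (1 - exp (- s * complex_of_real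
          (min 0 (a * W n \<omega> + S n \<omega> - A (n + 1) \<omega>)))) *
        exp (- \<eta> * complex_of_real (T (n + 1) \<omega>)) * of_bool (Y (n + 1) \<omega> = j))"
      (is "integrable M ?f")
    and "norm (idle_transform n s \<eta> j) \<le> 2"
proof -
  have [measurable]: "W n \<in> borel_measurable M" "S n \<in> borel_measurable M"
    "A (n + 1) \<in> borel_measurable M" "T (n + 1) \<in> borel_measurable M"
    "Y (n + 1) \<in> M \<rightarrow>\<^sub>M count_space UNIV"
    using W_measurable S_measurable A_measurable T_measurable Y_measurable n by auto
  have "1 \<le> n + 1" by simp
  from norm_exp_arrival_le_1[OF this \<eta>]
  have bound: "AE \<omega> in M. norm (?f \<omega>) \<le> 2"
  proof eventually_elim
    case (elim \<omega>)
    let ?x = "exp (- s * complex_of_real (min 0 (a * W n \<omega> + S n \<omega> - A (n + 1) \<omega>)))"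
    have "norm (1 - ?x) \<le> 2"
      using norm_triangle_ineq4[of 1 ?x] unfolding norm_exp_imaginary[OF s] by simp
    then have "norm (1 - ?x) * norm (exp (- \<eta> * complex_of_real (T (n + 1) \<omega>))) \<le> 2 * 1"
      using elim by (intro mult_mono) auto
    then show ?case by (simp add: norm_mult del: norm_exp_eq_Re)
  qed
  show int: "integrable M ?f"
    using bound by (rule integrable_const_bound) measurable
  have "norm (idle_transform n s \<eta> j) \<le> (LINT \<omega>|M. norm (?f \<omega>))"
    unfolding idle_transform_def by (rule integral_norm_bound)
  also have "\<dots> \<le> 2" using int bound by (intro integral_le_const) auto
  finally show "norm (idle_transform n s \<eta> j) \<le> 2" .
qed

text \<open>
  The \<open>n\<close>th step of the functional equation. The last service and interarrival times enter
  through the present \<open>G\<close>, everything else through the past \<open>H\<close>; the sum over \<open>i\<close> comes from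
  splitting according to the state \<open>Y n\<close>.
\<close>

lemma workload_transform_Suc:
  assumes n: "1 \<le> n" and s: "Re s = 0" and \<eta>: "0 \<le> Re \<eta>"
  shows "workload_transform (n + 1) s \<eta> j =
    (\<Sum>i\<in>UNIV. workload_transform n (complex_of_real a * s) \<eta> i *
      (LST (B i) (s + psi i (\<eta> - s)) * chi i j (\<eta> - s))) + idle_transform n s \<eta> j"
proof -
  define H where "H = (\<lambda>\<omega>. exp (- (complex_of_real a * s) * complex_of_real (W n \<omega>) -
    \<eta> * complex_of_real (T n \<omega>)))"
  define G where "G = (\<lambda>\<omega>. exp (- s * complex_of_real (S n \<omega>)) *
    (exp (- (\<eta> - s) * complex_of_real (A (n + 1) \<omega>)) * of_bool (Y (n + 1) \<omega> = j)))"
  let ?f = "\<lambda>\<omega>. exp (- s * complex_of_real (W (n + 1) \<omega>) - \<eta> * complex_of_real (T (n + 1) \<omega>)) *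
        of_bool (Y (n + 1) \<omega> = j)"
  let ?v = "\<lambda>\<omega>. (1 - exp (- s * complex_of_real
          (min 0 (a * W n \<omega> + S n \<omega> - A (n + 1) \<omega>)))) *
        exp (- \<eta> * complex_of_real (T (n + 1) \<omega>)) * of_bool (Y (n + 1) \<omega> = j)"
  have as: "Re (complex_of_real a * s) = 0" using s by simp
  have [measurable]: "S n \<in> borel_measurable M" "Y n \<in> M \<rightarrow>\<^sub>M count_space UNIV"
    "Y (n + 1) \<in> M \<rightarrow>\<^sub>M count_space UNIV" "A (n + 1) \<in> borel_measurable M"
    using S_measurable Y_measurable A_measurable n by auto
  have G_bound: "AE \<omega> in M. norm (G \<omega>) \<le> 1"
    using A_nonneg[OF n] by eventually_elim (use s \<eta> in \<open>auto simp: G_def norm_mult\<close>)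
  have int_HG: "integrable M (\<lambda>\<omega>. (H \<omega> * of_bool (Y n \<omega> = i)) * G \<omega>)" for i
  proof (rule Bochner_Integration.integrable_bound)
    show int: "integrable M (\<lambda>\<omega>. H \<omega> * of_bool (Y n \<omega> = i))"
      using workload_transform_integrable(1)[OF n as \<eta>] by (simp add: H_def)
    show "AE \<omega> in M. norm ((H \<omega> * of_bool (Y n \<omega> = i)) * G \<omega>) \<le> norm (H \<omega> * of_bool (Y n \<omega> = i))"
      using G_bound by eventually_elim (auto simp: norm_mult intro!: mult_left_le)
    show "(\<lambda>\<omega>. (H \<omega> * of_bool (Y n \<omega> = i)) * G \<omega>) \<in> borel_measurable M"
      using int unfolding G_def by measurable
  qed
  have pointwise: "?f \<omega> - ?v \<omega> = (\<Sum>i\<in>UNIV. (H \<omega> * of_bool (Y n \<omega> = i)) * G \<omega>)"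
    if \<omega>: "\<omega> \<in> space M" for \<omega>
  proof -
    let ?x = "a * W n \<omega> + S n \<omega> - A (n + 1) \<omega>"
    have T: "T (n + 1) \<omega> = T n \<omega> + A (n + 1) \<omega>" using A_eq[of "n + 1" \<omega>] n \<omega> by simp
    have "?f \<omega> = exp (- s * of_real (max 0 ?x)) * exp (- \<eta> * of_real (T (n + 1) \<omega>)) *
        of_bool (Y (n + 1) \<omega> = j)"
      using W_rec[OF n \<omega>] by (simp add: mult_exp_exp)
    then have "?f \<omega> - ?v \<omega> = exp (- s * of_real ?x) * exp (- \<eta> * of_real (T (n + 1) \<omega>)) *
        of_bool (Y (n + 1) \<omega> = j)"
      unfolding exp_positive_part by (simp only: ring_distribs) simp
    also have "exp (- s * of_real ?x) * exp (- \<eta> * of_real (T (n + 1) \<omega>)) =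
        H \<omega> * (exp (- s * of_real (S n \<omega>)) * exp (- (\<eta> - s) * of_real (A (n + 1) \<omega>)))"
      unfolding H_def mult_exp_exp T by (simp add: algebra_simps)
    also have "\<dots> * of_bool (Y (n + 1) \<omega> = j) = H \<omega> * G \<omega>"
      by (simp add: G_def mult.assoc)
    also have "\<dots> = (\<Sum>i\<in>UNIV. (H \<omega> * of_bool (Y n \<omega> = i)) * G \<omega>)"
      by (simp add: of_bool_def if_distrib[of "\<lambda>y. _ * y"] if_distrib[of "\<lambda>y. y * _"] cong: if_cong)
    finally show ?thesis .
  qed
  have "workload_transform (n + 1) s \<eta> j - idle_transform n s \<eta> j = (LINT \<omega>|M. ?f \<omega> - ?v \<omega>)"
    unfolding workload_transform_def idle_transform_def
    using workload_transform_integrable(1)[of "n + 1" s \<eta> j] idle_transform_integrable(1)[OF n s \<eta>, of j] s \<eta>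
    by (intro Bochner_Integration.integral_diff[symmetric]) auto
  also have "\<dots> = (LINT \<omega>|M. (\<Sum>i\<in>UNIV. (H \<omega> * of_bool (Y n \<omega> = i)) * G \<omega>))"
    using pointwise by (intro Bochner_Integration.integral_cong) auto
  also have "\<dots> = (\<Sum>i\<in>UNIV. LINT \<omega>|M. (H \<omega> * of_bool (Y n \<omega> = i)) * G \<omega>)"
    using int_HG by (intro Bochner_Integration.integral_sum) auto
  also have "\<dots> = (\<Sum>i\<in>UNIV. workload_transform n (complex_of_real a * s) \<eta> i *
      (LST (B i) (s + psi i (\<eta> - s)) * chi i j (\<eta> - s)))"
  proof (rule sum.cong)
    fix i
    have "H \<in> borel_measurable (past n)"
      unfolding H_def using past_W[of n n] past_T[of n n] n by measurable
    moreover have "AE \<omega> in M. norm (H \<omega>) \<le> 1"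
      using norm_exp_arrival_le_1[OF n \<eta>] s by (auto simp: H_def elim!: AE_mp)
    ultimately show "(LINT \<omega>|M. (H \<omega> * of_bool (Y n \<omega> = i)) * G \<omega>) =
        workload_transform n (complex_of_real a * s) \<eta> i *
          (LST (B i) (s + psi i (\<eta> - s)) * chi i j (\<eta> - s))"
      using s \<eta> unfolding G_def workload_transform_def H_def[symmetric]
      by (subst integral_past_mult_present[OF n, where C = 1]) (auto simp: H_def)
  qed simp
  finally show ?thesis by (simp add: algebra_simps)
qed

section \<open>Summation over all arrivals\<close>

lemma Z_transform_sums:
  assumes "Re s = 0" "0 \<le> Re \<eta>" "norm r < 1"
  shows "(\<lambda>n. r ^ Suc n * workload_transform (Suc n) s \<eta> j) sums Z_transform M W T Y r s \<eta> j"
proof -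
  have "summable (\<lambda>n. r * (r ^ n * workload_transform (Suc n) s \<eta> j))"
    using assms workload_transform_integrable(2)
    by (intro summable_mult summable_power_mult_bounded[where C = 1]) auto
  then have "summable (\<lambda>n. r ^ Suc n * workload_transform (Suc n) s \<eta> j)"
    by (simp add: mult.assoc)
  then show ?thesis
    unfolding Z_transform_def workload_transform_def by (rule summable_sums)
qed

lemma V_transform_sums:
  assumes "Re s = 0" "0 \<le> Re \<eta>" "norm r < 1"
  shows "(\<lambda>n. r ^ (Suc n + 1) * idle_transform (Suc n) s \<eta> j) sums V_transform M a W S A T Y r s \<eta> j"
proof -
  have "summable (\<lambda>n. r\<^sup>2 * (r ^ n * idle_transform (Suc n) s \<eta> j))"
    using assms idle_transform_integrable(2)
    by (intro summable_mult summable_power_mult_bounded[where C = 2]) auto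
  then have "summable (\<lambda>n. r ^ (Suc n + 1) * idle_transform (Suc n) s \<eta> j)"
    by (simp add: power2_eq_square mult.assoc)
  then show ?thesis
    unfolding V_transform_def idle_transform_def by (rule summable_sums)
qed

lemma workload_transform_1:
  "workload_transform 1 s \<eta> j = of_real \<P>(\<omega> in M. Y 1 \<omega> = j) * exp (- s * complex_of_real w)"
proof -
  have "workload_transform 1 s \<eta> j =
      (LINT \<omega>|M. exp (- s * complex_of_real w) * of_real (indicator {\<omega> \<in> space M. Y 1 \<omega> = j} \<omega>))"
    unfolding workload_transform_def using W_1 T_1
    by (intro Bochner_Integration.integral_cong) (auto simp: indicator_def)
  then show ?thesis using state_event[of 1 j] by simp
qed

text \<open>
  The one-step recursions are summed with weights \<open>r ^ (n + 1)\<close>, giving on one side the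
  \<open>Z\<close>-series without its first term.
\<close>

lemma Z_transform_equation:
  assumes s: "Re s = 0" and \<eta>: "0 \<le> Re \<eta>" and r: "norm r < 1"
  shows "Z_transform M W T Y r s \<eta> j
      - r * complex_of_real \<P>(\<omega> in M. Y 1 \<omega> = j) * exp (- s * complex_of_real w) =
    r * (\<Sum>i\<in>UNIV. Z_transform M W T Y r (complex_of_real a * s) \<eta> i
           * LST (B i) (s + psi i (\<eta> - s)) * chi i j (\<eta> - s))
    + V_transform M a W S A T Y r s \<eta> j"
proof -
  let ?c = "\<lambda>i. LST (B i) (s + psi i (\<eta> - s)) * chi i j (\<eta> - s)"
  have as: "Re (complex_of_real a * s) = 0" using s by simp
  have "(\<lambda>n. r * (\<Sum>i\<in>UNIV. (r ^ Suc n * workload_transform (Suc n) (complex_of_real a * s) \<eta> i) * ?c i)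
        + r ^ (Suc n + 1) * idle_transform (Suc n) s \<eta> j) sums
      (r * (\<Sum>i\<in>UNIV. Z_transform M W T Y r (complex_of_real a * s) \<eta> i * ?c i)
        + V_transform M a W S A T Y r s \<eta> j)"
    by (intro sums_add sums_mult sums_sum sums_mult2 Z_transform_sums V_transform_sums as s \<eta> r)
  also have "(\<lambda>n. r * (\<Sum>i\<in>UNIV. (r ^ Suc n * workload_transform (Suc n) (complex_of_real a * s) \<eta> i) * ?c i)
        + r ^ (Suc n + 1) * idle_transform (Suc n) s \<eta> j) =
      (\<lambda>n. r ^ Suc (Suc n) * workload_transform (Suc (Suc n)) s \<eta> j)"
    using workload_transform_Suc[OF _ s \<eta>, of "Suc _" j]
    by (auto simp: sum_distrib_left algebra_simps)
  finally have tail: "(\<lambda>n. r ^ Suc (Suc n) * workload_transform (Suc (Suc n)) s \<eta> j) sums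
      (r * (\<Sum>i\<in>UNIV. Z_transform M W T Y r (complex_of_real a * s) \<eta> i * ?c i)
        + V_transform M a W S A T Y r s \<eta> j)" .
  have "(\<lambda>n. r ^ Suc (Suc n) * workload_transform (Suc (Suc n)) s \<eta> j) sums
      (Z_transform M W T Y r s \<eta> j - r * workload_transform 1 s \<eta> j)"
    using Z_transform_sums[OF s \<eta> r, of j]
    by (subst sums_Suc_iff[where f = "\<lambda>n. r ^ Suc n * workload_transform (Suc n) s \<eta> j"]) simp
  from sums_unique2[OF this tail] show ?thesis
    by (simp only: workload_transform_1 mult.assoc)
qed

end

section \<open>The functional equation for the workload transforms\<close>

text \<open>
  The matrix form is the scalar form read row by row: multiplication by the diagonal matrix
  \<open>B_matrix\<close> scales the columns of \<open>X_matrix\<close>.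
\<close>

theorem theorem21:
  fixes M :: "'m measure" and a w :: real
    and T A S W :: "nat \<Rightarrow> 'm \<Rightarrow> real"
    and Y :: "nat \<Rightarrow> 'm \<Rightarrow> 'n::finite"
    and B :: "'n \<Rightarrow> real \<Rightarrow> real"
    and chi :: "'n \<Rightarrow> 'n \<Rightarrow> complex \<Rightarrow> complex"
    and psi :: "'n \<Rightarrow> complex \<Rightarrow> complex"
    and P1 :: "'n \<Rightarrow> 'n \<Rightarrow> complex poly" and L :: "'n \<Rightarrow> 'n \<Rightarrow> nat"
    and lam :: "'n \<Rightarrow> 'n \<Rightarrow> nat \<Rightarrow> complex"
    and P2 :: "'n \<Rightarrow> complex poly" and K :: "'n \<Rightarrow> nat"
    and nu :: "'n \<Rightarrow> nat \<Rightarrow> complex"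
    and r s \<eta> :: complex
  assumes "markov_dependent_workload M a w T A S Y W B chi psi P1 L lam P2 K nu"
    and "Re s = 0" and "0 \<le> Re \<eta>" and "norm r < 1"
  shows "(\<forall>j. Z_transform M W T Y r s \<eta> j
              - r * complex_of_real \<P>(\<omega> in M. Y 1 \<omega> = j) * exp (- s * complex_of_real w) =
            r * (\<Sum>i\<in>UNIV. Z_transform M W T Y r (complex_of_real a * s) \<eta> i
                   * LST (B i) (s + psi i (\<eta> - s)) * chi i j (\<eta> - s))
            + V_transform M a W S A T Y r s \<eta> j)
       \<and> (\<chi> j. Z_transform M W T Y r s \<eta> j)
           - r *s ((X_matrix chi (\<eta> - s) ** B_matrix B psi s \<eta>)
                     *v (\<chi> j. Z_transform M W T Y r (complex_of_real a * s) \<eta> j)) =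
         (r * exp (- s * complex_of_real w)) *s (\<chi> j. complex_of_real \<P>(\<omega> in M. Y 1 \<omega> = j))
           + (\<chi> j. V_transform M a W S A T Y r s \<eta> j)"

proof -
  interpret markov_dependent_workload M a w T A S Y W B chi psi P1 L lam P2 K nu by fact
  note equation = Z_transform_equation[OF assms(2-4)]
  have product: "X_matrix chi (\<eta> - s) ** B_matrix B psi s \<eta> =
      (\<chi> j i. chi i j (\<eta> - s) * LST (B i) (s + psi i (\<eta> - s)))"
    unfolding X_matrix_def B_matrix_def matrix_matrix_mult_def
    by (simp add: vec_eq_iff if_distrib[of "\<lambda>y. _ * y"] cong: if_cong)
  show ?thesis
  proof (intro conjI allI)
    show "(\<chi> j. Z_transform M W T Y r s \<eta> j)
           - r *s ((X_matrix chi (\<eta> - s) ** B_matrix B psi s \<eta>)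
                     *v (\<chi> j. Z_transform M W T Y r (complex_of_real a * s) \<eta> j)) =
         (r * exp (- s * complex_of_real w)) *s (\<chi> j. complex_of_real \<P>(\<omega> in M. Y 1 \<omega> = j))
           + (\<chi> j. V_transform M a W S A T Y r s \<eta> j)"
      unfolding product matrix_vector_mult_def vec_eq_iff
    proof
      fix j
      show "((\<chi> j. Z_transform M W T Y r s \<eta> j) - r *s (\<chi> j. \<Sum>i\<in>UNIV.
            (\<chi> j i. chi i j (\<eta> - s) * LST (B i) (s + psi i (\<eta> - s))) $ j $ i *
              (\<chi> j. Z_transform M W T Y r (complex_of_real a * s) \<eta> j) $ i)) $ j =
          ((r * exp (- s * complex_of_real w)) *s (\<chi> j. complex_of_real \<P>(\<omega> in M. Y 1 \<omega> = j))
            + (\<chi> j. V_transform M a W S A T Y r s \<eta> j)) $ j"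
        using equation[of j] by (simp add: algebra_simps)
    qed
  qed (rule equation)
qed

end
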